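(* Let $n\ge 2$. The submonoid $VSP_n$ is normal in $VSB_n$, and $VSB_n=VSP_n\rtimes_{\phi}S_n$, where $\phi: S_n\to\operatorname{Aut}(VSP_n)$ is the homomorphism associated with the conjugation action of $S_n$ on $VSP_n$, $\phi(\alpha)(\beta)=\alpha\beta\alpha^{-1}$. Equivalently, the map $VSP_n\rtimes_\phi S_n\to VSB_n$, $(\beta,\alpha)\mapsto\beta\alpha$, is an isomorphism of monoids.
   Context: $VSB_n$, the $n$-stranded virtual singular braid monoid, is the monoid, with identity $1_n$, presented by generators $\sigma_i,\sigma_i^{-1},v_i,\tau_i$ ($1\le i\le n-1$) and relations (indices range over all values in $\{1,\dots,n-1\}$ satisfying the indicated condition): (1) $\sigma_i\sigma_i^{-1}=\sigma_i^{-1}\sigma_i=1_n$; (2) $v_i^2=1_n$; (3) $\sigma_i\sigma_j\sigma_i=\sigma_j\sigma_i\sigma_j$ for $|i-j|=1$; (4) $v_iv_jv_i=v_jv_iv_j$ for $|i-j|=1$; (5) $v_i\sigma_jv_i=v_j\sigma_iv_j$ for $|i-j|=1$; (6) $v_i\tau_jv_i=v_j\tau_iv_j$ for $|i-j|=1$; (7) $\sigma_i\sigma_j\tau_i=\tau_j\sigma_i\sigma_j$ for $|i-j|=1$; (8) $\sigma_i\tau_i=\tau_i\sigma_i$; (9) $g_ih_j=h_jg_i$ for $|i-j|>1$, where $g_i\in\{\sigma_i,\tau_i,v_i\}$ and $h_j\in\{\sigma_j,\tau_j,v_j\}$. Let $S_n$ be the symmetric group on $n$ letters and let $\pi: VSB_n\to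 S_n$ be the monoid homomorphism sending each of $\sigma_i,\sigma_i^{-1},v_i,\tau_i$ to the transposition $(i\ \,i+1)$. The virtual singular pure braid monoid is $VSP_n=\ker(\pi)=\{\beta\in VSB_n\mid \pi(\beta)=\mathrm{id}\}$. The group $S_n$ is identified with the subgroup of $VSB_n$ generated by $v_1,\dots,v_{n-1}$, with $v_i$ corresponding to $(i\ \,i+1)$; it acts on $VSB_n$ by conjugation. "Normal" means that $\alpha\,VSP_n\,\alpha^{-1}=VSP_n$ for all $\alpha\in S_n\subset VSB_n$. For a monoid $N$, a group $H$ and a homomorphism $\phi:H\to\operatorname{Aut}(N)$, $N\rtimes_\phi H$ is the set $N\times H$ with multiplication $(\beta,\alpha)(\beta',\alpha')=(\beta\,\phi(\alpha)(\beta'),\alpha\alpha')$. *)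

theory Defs
  imports "HOL-Algebra.Sym_Groups" "HOL-Algebra.Bij"
begin

section \<open>Monoids given by generators and relations\<close>

inductive_set pres_cong :: "'g set \<Rightarrow> ('g list \<times> 'g list) set \<Rightarrow> ('g list \<times> 'g list) set"
  for A :: "'g set" and R :: "('g list \<times> 'g list) set"
where
  rel: "\<lbrakk>(u, w) \<in> R; u \<in> lists A; w \<in> lists A\<rbrakk> \<Longrightarrow> (u, w) \<in> pres_cong A R"
| refl: "u \<in> lists A \<Longrightarrow> (u, u) \<in> pres_cong A R"
| sym: "(u, w) \<in> pres_cong A R \<Longrightarrow> (w, u) \<in> pres_cong A R"
| trans: "\<lbrakk>(u, w) \<in> pres_cong A R; (w, x) \<in> pres_cong A R\<rbrakk> \<Longrightarrow> (u, x) \<in> pres_cong A R"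
| app: "\<lbrakk>(u, u') \<in> pres_cong A R; (w, w') \<in> pres_cong A R\<rbrakk> \<Longrightarrow> (u @ w, u' @ w') \<in> pres_cong A R"

definition pres_class :: "'g set \<Rightarrow> ('g list \<times> 'g list) set \<Rightarrow> 'g list \<Rightarrow> 'g list set"
  where "pres_class A R w = pres_cong A R `` {w}"

definition pres_monoid :: "'g set \<Rightarrow> ('g list \<times> 'g list) set \<Rightarrow> 'g list set monoid"
  where "pres_monoid A R =
    \<lparr>carrier = lists A // pres_cong A R,
     mult = (\<lambda>X Y. \<Union>u\<in>X. \<Union>w\<in>Y. pres_class A R (u @ w)),
     one = pres_class A R []\<rparr>"

lemma pres_cong_lists: "(u, w) \<in> pres_cong A R \<Longrightarrow> u \<in> lists A \<and> w \<in> lists A"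
  by (induction rule: pres_cong.induct) auto

lemma equiv_pres_cong: "equiv (lists A) (pres_cong A R)"
proof (rule equivI)
  show "pres_cong A R \<subseteq> lists A \<times> lists A"
    by (rule subrelI) (simp only: mem_Sigma_iff pres_cong_lists)
  show "refl_on (lists A) (pres_cong A R)"
    by (meson pres_cong.refl refl_onI)
  show "sym (pres_cong A R)"
    by (meson pres_cong.sym symI)
  show "trans (pres_cong A R)"
    by (meson pres_cong.trans transI)
qed

lemma pres_class_eq_iff:
  "\<lbrakk>u \<in> lists A; w \<in> lists A\<rbrakk> \<Longrightarrow> pres_class A R u = pres_class A R w \<longleftrightarrow> (u, w) \<in> pres_cong A R"
  unfolding pres_class_def using eq_equiv_class_iff[OF equiv_pres_cong] by metis

lemma pres_class_eqI: "(u, w) \<in> pres_cong A R \<Longrightarrow> pres_class A R u = pres_class A R w"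
  using pres_class_eq_iff pres_cong_lists by metis

lemma carrier_pres_monoid: "carrier (pres_monoid A R) = pres_class A R ` lists A"
  by (auto simp: pres_monoid_def pres_class_def quotient_def)

lemma one_pres_monoid: "\<one>\<^bsub>pres_monoid A R\<^esub> = pres_class A R []"
  by (simp add: pres_monoid_def)

lemma mult_pres_monoid:
  assumes "u \<in> lists A" "w \<in> lists A"
  shows "pres_class A R u \<otimes>\<^bsub>pres_monoid A R\<^esub> pres_class A R w = pres_class A R (u @ w)"
proof -
  have eq: "pres_class A R (u' @ w') = pres_class A R (u @ w)"
    if "u' \<in> pres_class A R u" "w' \<in> pres_class A R w" for u' w'
    using that by (intro pres_class_eqI) (auto simp: pres_class_def intro: pres_cong.intros)
  have "u \<in> pres_class A R u" "w \<in> pres_class A R w"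
    using assms by (auto simp: pres_class_def intro: pres_cong.refl)
  with eq have "(\<Union>u'\<in>pres_class A R u. \<Union>w'\<in>pres_class A R w. pres_class A R (u' @ w')) =
      pres_class A R (u @ w)"
    by blast
  then show ?thesis
    by (simp add: pres_monoid_def)
qed

lemma monoid_pres_monoid: "monoid (pres_monoid A R)"
proof -
  have *: "pres_class A R u \<otimes>\<^bsub>pres_monoid A R\<^esub> pres_class A R w = pres_class A R (u @ w)"
    if "\<forall>x\<in>set u. x \<in> A" "\<forall>x\<in>set w. x \<in> A" for u w
    using that by (intro mult_pres_monoid) auto
  have **: "pres_class A R u \<in> pres_class A R ` lists A" if "\<forall>x\<in>set u. x \<in> A" for u
    using that by auto
  show ?thesis
  proof (rule monoidI, goal_cases)
    case (1 x y)
    then show ?case by (auto simp only: carrier_pres_monoid in_lists_conv_set * set_append intro!: **)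
  next
    case 2
    then show ?case by (simp add: carrier_pres_monoid one_pres_monoid **)
  next
    case (3 x y z)
    then show ?case by (clarsimp simp: carrier_pres_monoid * ball_Un)
  next
    case (4 x)
    then show ?case by (clarsimp simp: carrier_pres_monoid one_pres_monoid *)
  next
    case (5 x)
    then show ?case by (clarsimp simp: carrier_pres_monoid one_pres_monoid *)
  qed
qed


section \<open>The virtual singular braid monoid\<close>

datatype vsb_gen = Sig nat | SigInv nat | Vir nat | Tau nat

definition vsb_gens :: "nat \<Rightarrow> vsb_gen set"
  where "vsb_gens n = (\<Union>i\<in>{1..<n}. {Sig i, SigInv i, Vir i, Tau i})"

inductive_set vsb_rels :: "nat \<Rightarrow> (vsb_gen list \<times> vsb_gen list) set"
  for n :: nat
where
  sig_inv_right: "i \<in> {1..<n} \<Longrightarrow> ([Sig i, SigInv i], []) \<in> vsb_rels n"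
| sig_inv_left: "i \<in> {1..<n} \<Longrightarrow> ([SigInv i, Sig i], []) \<in> vsb_rels n"
| vir_sq: "i \<in> {1..<n} \<Longrightarrow> ([Vir i, Vir i], []) \<in> vsb_rels n"
| sig_braid: "\<lbrakk>i \<in> {1..<n}; j \<in> {1..<n}; \<bar>int i - int j\<bar> = 1\<rbrakk> \<Longrightarrow>
    ([Sig i, Sig j, Sig i], [Sig j, Sig i, Sig j]) \<in> vsb_rels n"
| vir_braid: "\<lbrakk>i \<in> {1..<n}; j \<in> {1..<n}; \<bar>int i - int j\<bar> = 1\<rbrakk> \<Longrightarrow>
    ([Vir i, Vir j, Vir i], [Vir j, Vir i, Vir j]) \<in> vsb_rels n"
| vir_sig: "\<lbrakk>i \<in> {1..<n}; j \<in> {1..<n}; \<bar>int i - int j\<bar> = 1\<rbrakk> \<Longrightarrow>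
    ([Vir i, Sig j, Vir i], [Vir j, Sig i, Vir j]) \<in> vsb_rels n"
| vir_tau: "\<lbrakk>i \<in> {1..<n}; j \<in> {1..<n}; \<bar>int i - int j\<bar> = 1\<rbrakk> \<Longrightarrow>
    ([Vir i, Tau j, Vir i], [Vir j, Tau i, Vir j]) \<in> vsb_rels n"
| sig_sig_tau: "\<lbrakk>i \<in> {1..<n}; j \<in> {1..<n}; \<bar>int i - int j\<bar> = 1\<rbrakk> \<Longrightarrow>
    ([Sig i, Sig j, Tau i], [Tau j, Sig i, Sig j]) \<in> vsb_rels n"
| sig_tau: "i \<in> {1..<n} \<Longrightarrow> ([Sig i, Tau i], [Tau i, Sig i]) \<in> vsb_rels n"
| far_comm: "\<lbrakk>i \<in> {1..<n}; j \<in> {1..<n}; \<bar>int i - int j\<bar> > 1;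
     g \<in> {Sig i, Tau i, Vir i}; h \<in> {Sig j, Tau j, Vir j}\<rbrakk> \<Longrightarrow>
    ([g, h], [h, g]) \<in> vsb_rels n"

definition VSB :: "nat \<Rightarrow> vsb_gen list set monoid"
  where "VSB n = pres_monoid (vsb_gens n) (vsb_rels n)"

abbreviation vsb_class :: "nat \<Rightarrow> vsb_gen list \<Rightarrow> vsb_gen list set"
  where "vsb_class n \<equiv> pres_class (vsb_gens n) (vsb_rels n)"

definition vsb_vir :: "nat \<Rightarrow> nat \<Rightarrow> vsb_gen list set"
  where "vsb_vir n i = vsb_class n [Vir i]"

lemma monoid_VSB: "monoid (VSB n)"
  unfolding VSB_def by (rule monoid_pres_monoid)

fun gen_perm :: "vsb_gen \<Rightarrow> nat \<Rightarrow> nat" where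
  "gen_perm (Sig i) = transpose i (Suc i)"
| "gen_perm (SigInv i) = transpose i (Suc i)"
| "gen_perm (Vir i) = transpose i (Suc i)"
| "gen_perm (Tau i) = transpose i (Suc i)"

fun word_perm :: "vsb_gen list \<Rightarrow> nat \<Rightarrow> nat" where
  "word_perm [] = id"
| "word_perm (g # w) = gen_perm g \<circ> word_perm w"

text \<open>\<open>word_perm\<close> is constant on congruence classes; see \<open>vsb_perm_class\<close> below.\<close>

definition vsb_perm :: "nat \<Rightarrow> vsb_gen list set \<Rightarrow> (nat \<Rightarrow> nat)"
  where "vsb_perm n X = the_elem (word_perm ` X)"

lemma word_perm_append: "word_perm (u @ w) = word_perm u \<circ> word_perm w"
  by (induction u) (auto simp: o_assoc)

lemma word_perm_rel: "(u, w) \<in> vsb_rels n \<Longrightarrow> word_perm u = word_perm w"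
  by (induction rule: vsb_rels.induct) (auto simp: fun_eq_iff transpose_def)

lemma word_perm_cong:
  "(u, w) \<in> pres_cong (vsb_gens n) (vsb_rels n) \<Longrightarrow> word_perm u = word_perm w"
  by (induction rule: pres_cong.induct) (auto simp: word_perm_append dest: word_perm_rel)

lemma vsb_perm_class:
  assumes "w \<in> lists (vsb_gens n)"
  shows "vsb_perm n (vsb_class n w) = word_perm w"
proof -
  have "w \<in> vsb_class n w"
    using assms by (auto simp: pres_class_def intro: pres_cong.refl)
  moreover have "word_perm u = word_perm w" if "u \<in> vsb_class n w" for u
    using that word_perm_cong by (fastforce simp: pres_class_def)
  ultimately have "word_perm ` vsb_class n w = {word_perm w}"
    by blast
  then show ?thesis
    by (simp add: vsb_perm_def)
qed

lemma word_perm_permutes: "w \<in> lists (vsb_gens n) \<Longrightarrow> word_perm w permutes {1..n}"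
proof (induction w)
  case Nil
  then show ?case by (simp only: word_perm.simps permutes_id)
next
  case (Cons g w)
  then have "gen_perm g permutes {1..n}"
    by (auto simp: vsb_gens_def intro!: permutes_swap_id)
  moreover have "word_perm w permutes {1..n}"
    using Cons by simp
  ultimately show ?case
    unfolding word_perm.simps by (rule permutes_compose[rotated])
qed

lemma vsb_perm_hom: "vsb_perm n \<in> hom (VSB n) (sym_group n)"
proof (rule homI)
  fix x y assume "x \<in> carrier (VSB n)" "y \<in> carrier (VSB n)"
  then obtain u w where uw: "u \<in> lists (vsb_gens n)" "w \<in> lists (vsb_gens n)"
    and xy: "x = vsb_class n u" "y = vsb_class n w"
    by (auto simp: VSB_def carrier_pres_monoid)
  then have app: "u @ w \<in> lists (vsb_gens n)"
    by simp
  show "vsb_perm n x \<in> carrier (sym_group n)"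
    using word_perm_permutes[OF uw(1)] uw xy by (simp add: vsb_perm_class sym_group_carrier del: in_lists_conv_set)
  show "vsb_perm n (x \<otimes>\<^bsub>VSB n\<^esub> y) = vsb_perm n x \<otimes>\<^bsub>sym_group n\<^esub> vsb_perm n y"
    using vsb_perm_class[OF app] uw xy
    by (simp add: VSB_def mult_pres_monoid vsb_perm_class sym_group_mult word_perm_append
          del: in_lists_conv_set)
qed

lemma vsb_perm_gen:
  "i \<in> {1..<n} \<Longrightarrow> g \<in> {Sig i, SigInv i, Vir i, Tau i} \<Longrightarrow>
    vsb_perm n (vsb_class n [g]) = transpose i (Suc i)"
  by (subst vsb_perm_class) (auto simp: vsb_gens_def)

definition VSP :: "nat \<Rightarrow> vsb_gen list set monoid"
  where "VSP n = VSB n \<lparr>carrier := kernel (VSB n) (sym_group n) (vsb_perm n)\<rparr>"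


section \<open>The symmetric group inside the virtual singular braid monoid\<close>

definition vsb_sym :: "nat \<Rightarrow> vsb_gen list set set"
  where "vsb_sym n = generate (VSB n) (vsb_vir n ` {1..<n})"

text \<open>
  \<open>vsb_perm n\<close> maps \<open>vsb_sym n\<close> bijectively onto the symmetric group, and the inverse of this
  bijection is the identification sending each simple transposition to the corresponding virtual
  generator; see \<open>sym_emb_iso\<close> and \<open>sym_emb_transpose\<close> below.
\<close>

definition sym_emb :: "nat \<Rightarrow> (nat \<Rightarrow> nat) \<Rightarrow> vsb_gen list set"
  where "sym_emb n = inv_into (vsb_sym n) (vsb_perm n)"

abbreviation vsb_eq :: "nat \<Rightarrow> vsb_gen list \<Rightarrow> vsb_gen list \<Rightarrow> bool"
  where "vsb_eq n u w \<equiv> (u, w) \<in> pres_cong (vsb_gens n) (vsb_rels n)"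

lemma vir_lists: "set ks \<subseteq> {1..<n} \<Longrightarrow> map Vir ks \<in> lists (vsb_gens n)"
  by (auto simp: vsb_gens_def subset_iff)

lemma vsb_eq_ctx:
  assumes "vsb_eq n u w" "a \<in> lists (vsb_gens n)" "b \<in> lists (vsb_gens n)"
  shows "vsb_eq n (a @ u @ b) (a @ w @ b)"
  using assms by (intro pres_cong.app) (auto intro: pres_cong.refl)

lemma vir_far:
  assumes "set xs \<subseteq> {1..<n}" "i \<in> {1..<n}" "\<And>x. x \<in> set xs \<Longrightarrow> \<bar>int x - int i\<bar> > 1"
  shows "vsb_eq n (map Vir (xs @ [i])) (map Vir (i # xs))"
  using assms
proof (induction xs)
  case Nil
  then show ?case using vir_lists[of "[i]" n] by (auto intro: pres_cong.refl)
next
  case (Cons x xs)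
  have "vsb_eq n ([Vir x] @ map Vir (xs @ [i]) @ []) ([Vir x] @ map Vir (i # xs) @ [])"
    using Cons vir_lists[of "[x]" n] by (intro vsb_eq_ctx) auto
  moreover have "vsb_eq n ([] @ [Vir x, Vir i] @ map Vir xs) ([] @ [Vir i, Vir x] @ map Vir xs)"
    using Cons.prems vir_lists[of "[x,i]" n] vir_lists[of xs n]
    by (intro vsb_eq_ctx pres_cong.rel vsb_rels.far_comm[of x n i]) auto
  ultimately show ?case
    using pres_cong.trans by fastforce
qed

text \<open>Coset normal form: \<open>map Vir (rev [k..<m])\<close>, for \<open>1 \<le> k \<le> m\<close>, represent the right cosets of the
  subgroup generated by the first \<open>m - 2\<close> virtual generators in the one generated by \<open>m - 1\<close>.\<close>

lemma coset_step:
  assumes k: "1 \<le> k" "k \<le> m" and m: "m \<le> n" and i: "i \<in> {1..<m}"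
  shows "\<exists>ks' k'. set ks' \<subseteq> {1..<m - 1} \<and> 1 \<le> k' \<and> k' \<le> m \<and>
    vsb_eq n (map Vir (rev [k..<m] @ [i])) (map Vir (ks' @ rev [k'..<m]))"
proof -
  consider "i = k - 1" | "i = k" | "i < k - 1" | "i > k" by linarith
  then show ?thesis
  proof cases
    case 1
    with k i have "rev [k..<m] @ [i] = rev [i..<m]"
      by (subst (2) upt_conv_Cons) auto
    moreover have "set (rev [i..<m]) \<subseteq> {1..<n}" using i m by auto
    ultimately show ?thesis
      using i by (intro exI[of _ "[]"] exI[of _ i]) (auto intro: pres_cong.refl[OF vir_lists, of "rev [i..<m]", simplified])
  next
    case 2
    then have e: "rev [k..<m] @ [i] = rev [Suc k..<m] @ [k, k]"
      using i by (simp add: upt_conv_Cons)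
    have "vsb_eq n (map Vir (rev [Suc k..<m]) @ [Vir k, Vir k] @ [])
        (map Vir (rev [Suc k..<m]) @ [] @ [])"
      using k i m 2 vir_lists[of "[k,k]" n]
      by (intro vsb_eq_ctx pres_cong.rel vsb_rels.vir_sq vir_lists) auto
    then show ?thesis
      using i k 2 unfolding e by (intro exI[of _ "[]"] exI[of _ "Suc k"]) auto
  next
    case 3
    have "vsb_eq n (map Vir (rev [k..<m] @ [i])) (map Vir (i # rev [k..<m]))"
      using 3 k i m by (intro vir_far) auto
    then show ?thesis
      using 3 k i by (intro exI[of _ "[i]"] exI[of _ k]) auto
  next
    case 4
    define A where "A = rev [Suc i..<m]"
    define B where "B = rev [k..<i - 1]"
    have "[k..<m] = [k..<i - 1] @ [i - 1..<m]"
      using 4 i upt_add_eq_append[of k "i - 1" "m - (i - 1)"] by auto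
    moreover have "[i - 1..<m] = (i - 1) # i # [Suc i..<m]"
      using 4 i by (simp add: upt_conv_Cons)
    ultimately have e: "rev [k..<m] = A @ [i, i - 1] @ B"
      by (simp add: A_def B_def)
    have A: "map Vir A \<in> lists (vsb_gens n)" and B: "map Vir B \<in> lists (vsb_gens n)"
      unfolding A_def B_def using i k m by (intro vir_lists; auto)+
    have three: "[Vir i, Vir (i-1), Vir i] \<in> lists (vsb_gens n)"
      "[Vir (i-1), Vir i, Vir (i-1)] \<in> lists (vsb_gens n)"
      using i 4 k m by (auto simp: vsb_gens_def)
    have "vsb_eq n (map Vir (A @ [i, i-1]) @ map Vir (B @ [i]) @ []) (map Vir (A @ [i, i-1]) @ map Vir (i # B) @ [])"
      using A three by (intro vsb_eq_ctx vir_far) (use 4 i k m in \<open>auto simp: B_def\<close>)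
    moreover have "vsb_eq n (map Vir A @ [Vir i, Vir (i-1), Vir i] @ map Vir B)
       (map Vir A @ [Vir (i-1), Vir i, Vir (i-1)] @ map Vir B)"
      using A B three 4 i k m by (intro vsb_eq_ctx pres_cong.rel vsb_rels.vir_braid) auto
    moreover have "vsb_eq n ([] @ map Vir (A @ [i-1]) @ [Vir i, Vir (i-1)] @ map Vir B)
       ([] @ map Vir ((i-1) # A) @ [Vir i, Vir (i-1)] @ map Vir B)"
      using B three by (intro vsb_eq_ctx vir_far) (use 4 i k m in \<open>auto simp: A_def\<close>)
    ultimately have "vsb_eq n (map Vir (rev [k..<m] @ [i])) (map Vir ([i-1] @ rev [k..<m]))"
      unfolding e by (simp, meson pres_cong.trans)
    then show ?thesis
      using 4 i k by (intro exI[of _ "[i - 1]"] exI[of _ k]) auto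
  qed
qed

lemma coset_form:
  assumes "1 \<le> m" "m \<le> n" "set ks \<subseteq> {1..<m}"
  shows "\<exists>ks' k. set ks' \<subseteq> {1..<m - 1} \<and> 1 \<le> k \<and> k \<le> m \<and>
    vsb_eq n (map Vir ks) (map Vir (ks' @ rev [k..<m]))"
  using assms(3)
proof (induction ks rule: rev_induct)
  case Nil
  then show ?case
    using assms by (intro exI[of _ "[]"] exI[of _ m]) (auto intro: pres_cong.refl)
next
  case (snoc i ks)
  then obtain ks' k where 1: "set ks' \<subseteq> {1..<m - 1}" "1 \<le> k" "k \<le> m"
    "vsb_eq n (map Vir ks) (map Vir (ks' @ rev [k..<m]))"
    by auto
  from snoc have i: "i \<in> {1..<m}" by auto
  then obtain ls k' where 2: "set ls \<subseteq> {1..<m - 1}" "1 \<le> k'" "k' \<le> m"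
    "vsb_eq n (map Vir (rev [k..<m] @ [i])) (map Vir (ls @ rev [k'..<m]))"
    using coset_step[OF 1(2,3) assms(2)] by blast
  have ks': "map Vir ks' \<in> lists (vsb_gens n)"
    using 1 assms by (intro vir_lists) (auto simp: subset_iff)
  have "vsb_eq n ([] @ map Vir ks @ [Vir i]) ([] @ map Vir (ks' @ rev [k..<m]) @ [Vir i])"
    using 1 i assms vir_lists[of "[i]" n] by (intro vsb_eq_ctx) auto
  moreover have "vsb_eq n (map Vir ks' @ map Vir (rev [k..<m] @ [i]) @ []) (map Vir ks' @ map Vir (ls @ rev [k'..<m]) @ [])"
    using 2 ks' by (intro vsb_eq_ctx) auto
  ultimately have "vsb_eq n (map Vir (ks @ [i])) (map Vir ((ks' @ ls) @ rev [k'..<m]))"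
    by (simp, meson pres_cong.trans)
  then show ?case
    using 1 2 by (intro exI[of _ "ks' @ ls"] exI[of _ k']) auto
qed

lemma word_perm_coset: "k \<le> m \<Longrightarrow> word_perm (map Vir (rev [k..<m])) k = m"
  by (induction m) (auto simp: le_Suc_eq)

lemma word_perm_vir_permutes:
  assumes "set ks \<subseteq> {1..<m}"
  shows "word_perm (map Vir ks) permutes {1..m}"
  using vir_lists[OF assms] by (rule word_perm_permutes)

lemma word_perm_fix: "set ks \<subseteq> {1..<m - 1} \<Longrightarrow> word_perm (map Vir ks) m = m"
  by (induction ks) (auto simp: transpose_def)

lemma vir_kernel:
  assumes "m \<le> n" "set ks \<subseteq> {1..<m}" "word_perm (map Vir ks) = id"
  shows "vsb_eq n (map Vir ks) []"
  using assms
proof (induction m arbitrary: ks)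
  case 0
  then show ?case by (auto intro: pres_cong.refl)
next
  case (Suc m)
  obtain ks' k where 1: "set ks' \<subseteq> {1..<m}" "1 \<le> k" "k \<le> Suc m"
    "vsb_eq n (map Vir ks) (map Vir (ks' @ rev [k..<Suc m]))"
    using coset_form[of "Suc m" n ks] Suc.prems by auto
  have e: "word_perm (map Vir ks) = word_perm (map Vir ks') \<circ> word_perm (map Vir (rev [k..<Suc m]))"
    using word_perm_cong[OF 1(4)] word_perm_append[of "map Vir ks'" "map Vir (rev [k..<Suc m])"]
    by (simp del: upt_Suc)
  have "word_perm (map Vir ks) k = Suc m"
    using word_perm_coset[of k "Suc m"] word_perm_fix[of ks' "Suc m"] 1 unfolding e
    by (simp del: upt_Suc)
  with Suc.prems(3) have k: "k = Suc m" by simp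
  with e Suc.prems(3) have "word_perm (map Vir ks') = id" by (simp add: fun_eq_iff)
  with Suc.IH[of ks'] Suc.prems(1) 1 have "vsb_eq n (map Vir ks') []" by simp
  with 1 k show ?case by (auto intro: pres_cong.trans)
qed

lemma vir_rev:
  assumes "set ks \<subseteq> {1..<n}"
  shows "vsb_eq n (map Vir (rev ks @ ks)) []"
  using assms
proof (induction ks)
  case Nil
  then show ?case by (auto intro: pres_cong.refl)
next
  case (Cons i ks)
  have "vsb_eq n (map Vir (rev ks) @ [Vir i, Vir i] @ map Vir ks) (map Vir (rev ks) @ [] @ map Vir ks)"
    using Cons.prems vir_lists[of "[i,i]" n]
    by (intro vsb_eq_ctx pres_cong.rel vsb_rels.vir_sq vir_lists) auto
  with Cons show ?case
    by (auto intro: pres_cong.trans)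
qed

lemma word_perm_rev: "word_perm (map Vir (rev ks)) \<circ> word_perm (map Vir ks) = id"
proof (induction ks)
  case (Cons i ks)
  then show ?case
    by (auto simp: word_perm_append fun_eq_iff)
qed simp

lemma vir_inj:
  assumes "set ks \<subseteq> {1..<n}" "set ls \<subseteq> {1..<n}" "word_perm (map Vir ks) = word_perm (map Vir ls)"
  shows "vsb_eq n (map Vir ks) (map Vir ls)"
proof -
  have "word_perm (map Vir (ks @ rev ls)) = word_perm (map Vir (rev (rev ls))) \<circ> word_perm (map Vir (rev ls))"
    by (simp add: word_perm_append assms(3))
  also have "\<dots> = id" by (rule word_perm_rev)
  finally have 1: "vsb_eq n (map Vir (ks @ rev ls)) []"
    using assms by (intro vir_kernel[of n]) auto
  have "vsb_eq n ([] @ map Vir (ks @ rev ls) @ map Vir ls) ([] @ [] @ map Vir ls)"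
    using 1 assms by (intro vsb_eq_ctx vir_lists) auto
  moreover have "vsb_eq n (map Vir ks @ map Vir (rev ls @ ls) @ []) (map Vir ks @ [] @ [])"
    using assms by (intro vsb_eq_ctx vir_lists vir_rev) auto
  ultimately show ?thesis
    by (simp, meson pres_cong.trans pres_cong.sym)
qed

lemma vir_surj:
  assumes "p permutes {1..m}"
  shows "\<exists>ks. set ks \<subseteq> {1..<m} \<and> word_perm (map Vir ks) = p"
  using assms
proof (induction m arbitrary: p)
  case 0
  then show ?case by (intro exI[of _ "[]"]) auto
next
  case (Suc m)
  define k where "k = inv' p (Suc m)"
  have pk: "p k = Suc m"
    unfolding k_def using permutes_inverses(1)[OF Suc.prems] by simp
  have k: "1 \<le> k" "k \<le> Suc m"
    using permutes_in_image[OF Suc.prems, of k] pk by auto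
  define T where "T = word_perm (map Vir (rev [k..<Suc m]))"
  define U where "U = word_perm (map Vir [k..<Suc m])"
  have UT: "U \<circ> T = id"
    using word_perm_rev[of "rev [k..<Suc m]"] unfolding U_def T_def by (simp del: upt_Suc)
  have U: "U permutes {1..Suc m}"
    unfolding U_def using k by (intro word_perm_vir_permutes) auto
  have Tk: "T k = Suc m"
    unfolding T_def using k by (intro word_perm_coset)
  then have "U (Suc m) = k"
    using UT by (metis comp_apply id_apply)
  with pk have "(p \<circ> U) (Suc m) = Suc m" by simp
  moreover have pU: "p \<circ> U permutes {1..Suc m}"
    using permutes_compose[OF U Suc.prems] .
  ultimately have "p \<circ> U permutes {1..m}"
    by (intro permutes_superset[OF pU]) (auto simp: le_Suc_eq)
  then obtain ks where ks: "set ks \<subseteq> {1..<m}" "word_perm (map Vir ks) = p \<circ> U"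
    using Suc.IH by blast
  have "word_perm (map Vir (ks @ rev [k..<Suc m])) = (p \<circ> U) \<circ> T"
    unfolding T_def ks(2)[symmetric] map_append word_perm_append ..
  also have "\<dots> = p" using UT by (simp add: comp_assoc)
  finally show ?case
    using ks k by (intro exI[of _ "ks @ rev [k..<Suc m]"]) auto
qed

lemma vsb_sym_eq: "vsb_sym n = {vsb_class n (map Vir ks) |ks. set ks \<subseteq> {1..<n}}"
proof -
  interpret monoid "VSB n" by (rule monoid_VSB)
  have mult: "vsb_class n (map Vir ks) \<otimes>\<^bsub>VSB n\<^esub> vsb_class n (map Vir ls) = vsb_class n (map Vir (ks @ ls))"
    if "set ks \<subseteq> {1..<n}" "set ls \<subseteq> {1..<n}" for ks ls
    using mult_pres_monoid[OF vir_lists[OF that(1)] vir_lists[OF that(2)]] by (simp add: VSB_def)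
  have inv: "inv\<^bsub>VSB n\<^esub> (vsb_vir n i) = vsb_vir n i" if "i \<in> {1..<n}" for i
  proof (rule inv_unique'[symmetric])
    show "vsb_vir n i \<in> carrier (VSB n)" "vsb_vir n i \<in> carrier (VSB n)"
      using that vir_lists[of "[i]" n] by (auto simp: vsb_vir_def VSB_def carrier_pres_monoid)
    have "vsb_vir n i \<otimes>\<^bsub>VSB n\<^esub> vsb_vir n i = vsb_class n [Vir i, Vir i]"
      using mult[of "[i]" "[i]"] that by (simp add: vsb_vir_def)
    also have "\<dots> = \<one>\<^bsub>VSB n\<^esub>"
      using that vir_lists[of "[i,i]" n] unfolding VSB_def one_pres_monoid
      by (intro pres_class_eqI pres_cong.rel vsb_rels.vir_sq) auto
    finally show "vsb_vir n i \<otimes>\<^bsub>VSB n\<^esub> vsb_vir n i = \<one>\<^bsub>VSB n\<^esub>"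
      "vsb_vir n i \<otimes>\<^bsub>VSB n\<^esub> vsb_vir n i = \<one>\<^bsub>VSB n\<^esub>" by auto
  qed
  show ?thesis
  proof (intro equalityI subsetI)
    fix x assume "x \<in> vsb_sym n"
    then have "x \<in> generate (VSB n) (vsb_vir n ` {1..<n})" by (simp add: vsb_sym_def)
    then show "x \<in> {vsb_class n (map Vir ks) |ks. set ks \<subseteq> {1..<n}}"
    proof induction
      case one
      then show ?case by (auto simp: VSB_def one_pres_monoid intro!: exI[of _ "[]"])
    next
      case (incl h)
      then obtain i where "i \<in> {1..<n}" "h = vsb_vir n i" by auto
      then show ?case by (auto simp: vsb_vir_def intro!: exI[of _ "[i]"])
    next
      case (inv h)
      then obtain i where "i \<in> {1..<n}" "h = vsb_vir n i" by auto
      with \<open>\<And>i. i \<in> {1..<n} \<Longrightarrow> inv\<^bsub>VSB n\<^esub> (vsb_vir n i) = vsb_vir n i\<close> show ?case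
        by (auto simp: vsb_vir_def intro!: exI[of _ "[i]"])
    next
      case (eng h1 h2)
      then obtain ks ls where "set ks \<subseteq> {1..<n}" "set ls \<subseteq> {1..<n}"
        "h1 = vsb_class n (map Vir ks)" "h2 = vsb_class n (map Vir ls)" by blast
      moreover from this have "set (ks @ ls) \<subseteq> {1..<n}" by simp
      ultimately show ?case using mult by blast
    qed
  next
    fix x assume "x \<in> {vsb_class n (map Vir ks) |ks. set ks \<subseteq> {1..<n}}"
    then obtain ks where "set ks \<subseteq> {1..<n}" "x = vsb_class n (map Vir ks)" by blast
    then show "x \<in> vsb_sym n"
    proof (induction ks arbitrary: x)
      case Nil
      then show ?case
        using generate.one[of "VSB n"] by (simp add: vsb_sym_def VSB_def one_pres_monoid)
    next
      case (Cons i ks)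
      then have "vsb_vir n i \<in> vsb_sym n" "vsb_class n (map Vir ks) \<in> vsb_sym n"
        by (auto simp: vsb_sym_def intro: generate.incl)
      then have "vsb_vir n i \<otimes>\<^bsub>VSB n\<^esub> vsb_class n (map Vir ks) \<in> vsb_sym n"
        unfolding vsb_sym_def by (rule generate.eng)
      with Cons.prems mult[of "[i]" ks] show ?case
        by (simp add: vsb_vir_def)
    qed
  qed
qed

lemma vsb_perm_vir_word: "set ks \<subseteq> {1..<n} \<Longrightarrow> vsb_perm n (vsb_class n (map Vir ks)) = word_perm (map Vir ks)"
  by (intro vsb_perm_class vir_lists)

lemma vsb_perm_bij: "bij_betw (vsb_perm n) (vsb_sym n) (carrier (sym_group n))"
proof (rule bij_betw_imageI)
  show "inj_on (vsb_perm n) (vsb_sym n)"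
  proof (rule inj_onI)
    fix x y assume "x \<in> vsb_sym n" "y \<in> vsb_sym n" and eq: "vsb_perm n x = vsb_perm n y"
    then obtain ks ls where *: "set ks \<subseteq> {1..<n}" "set ls \<subseteq> {1..<n}"
      "x = vsb_class n (map Vir ks)" "y = vsb_class n (map Vir ls)"
      unfolding vsb_sym_eq by blast
    with eq have "word_perm (map Vir ks) = word_perm (map Vir ls)"
      by (simp add: vsb_perm_vir_word)
    with * show "x = y" by (simp add: pres_class_eqI vir_inj)
  qed
  show "vsb_perm n ` vsb_sym n = carrier (sym_group n)"
  proof (intro equalityI subsetI)
    fix p assume "p \<in> vsb_perm n ` vsb_sym n"
    then show "p \<in> carrier (sym_group n)"
      by (auto simp: vsb_sym_eq vsb_perm_vir_word sym_group_carrier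
          simp del: One_nat_def intro: word_perm_vir_permutes)
  next
    fix p assume "p \<in> carrier (sym_group n)"
    then obtain ks where ks: "set ks \<subseteq> {1..<n}" "word_perm (map Vir ks) = p"
      using vir_surj by (auto simp: sym_group_carrier)
    then have "p = vsb_perm n (vsb_class n (map Vir ks))" "vsb_class n (map Vir ks) \<in> vsb_sym n"
      by (auto simp: vsb_perm_vir_word vsb_sym_eq)
    then show "p \<in> vsb_perm n ` vsb_sym n" by (rule image_eqI)
  qed
qed

lemma vsb_perm_iso: "vsb_perm n \<in> iso (VSB n \<lparr>carrier := vsb_sym n\<rparr>) (sym_group n)"
proof -
  have "vsb_sym n \<subseteq> carrier (VSB n)"
    unfolding vsb_sym_eq VSB_def carrier_pres_monoid using vir_lists by blast
  then have "vsb_perm n \<in> hom (VSB n \<lparr>carrier := vsb_sym n\<rparr>) (sym_group n)"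
    using vsb_perm_hom by (fastforce simp: hom_def)
  with vsb_perm_bij show ?thesis by (simp add: iso_def)
qed

lemma monoid_vsb_sym: "monoid (VSB n \<lparr>carrier := vsb_sym n\<rparr>)"
proof (rule submonoid.submonoid_is_monoid[OF submonoid.intro monoid_VSB])
  show "vsb_sym n \<subseteq> carrier (VSB n)"
    unfolding vsb_sym_eq VSB_def carrier_pres_monoid using vir_lists by blast
qed (auto simp: vsb_sym_def intro: generate.intros)

lemma sym_emb_iso: "sym_emb n \<in> iso (sym_group n) (VSB n \<lparr>carrier := vsb_sym n\<rparr>)"
proof -
  let ?V = "VSB n \<lparr>carrier := vsb_sym n\<rparr>"
  interpret V: monoid ?V by (rule monoid_vsb_sym)
  have bij: "bij_betw (sym_emb n) (carrier (sym_group n)) (vsb_sym n)"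
    unfolding sym_emb_def by (rule bij_betw_inv_into[OF vsb_perm_bij])
  have "sym_emb n (p \<otimes>\<^bsub>sym_group n\<^esub> q) = sym_emb n p \<otimes>\<^bsub>VSB n\<^esub> sym_emb n q"
    if pq: "p \<in> carrier (sym_group n)" "q \<in> carrier (sym_group n)" for p q
  proof -
    have in_sym: "sym_emb n p \<in> vsb_sym n" "sym_emb n q \<in> vsb_sym n"
      using bij pq by (auto dest: bij_betwE)
    then have prod: "sym_emb n p \<otimes>\<^bsub>VSB n\<^esub> sym_emb n q \<in> vsb_sym n"
      using V.m_closed by simp
    have "vsb_perm n (sym_emb n p \<otimes>\<^bsub>VSB n\<^esub> sym_emb n q) =
        vsb_perm n (sym_emb n p) \<otimes>\<^bsub>sym_group n\<^esub> vsb_perm n (sym_emb n q)"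
      using vsb_perm_iso[of n] in_sym by (simp add: iso_def hom_def)
    also have "\<dots> = p \<otimes>\<^bsub>sym_group n\<^esub> q"
      using pq bij_betw_inv_into_right[OF vsb_perm_bij] by (simp add: sym_emb_def)
    finally show ?thesis
      using bij_betw_inv_into_left[OF vsb_perm_bij prod] by (simp add: sym_emb_def)
  qed
  with bij show ?thesis
    by (auto simp: iso_def hom_def dest: bij_betwE)
qed

lemma sym_emb_transpose:
  assumes "i \<in> {1..<n}"
  shows "sym_emb n (transpose i (Suc i)) = vsb_vir n i"
proof -
  have "vsb_vir n i \<in> vsb_sym n"
    using assms by (auto simp: vsb_sym_def intro: generate.incl)
  moreover have "vsb_perm n (vsb_vir n i) = transpose i (Suc i)"
    using assms by (simp add: vsb_vir_def vsb_perm_gen)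
  ultimately show ?thesis
    unfolding sym_emb_def using bij_betw_inv_into_left[OF vsb_perm_bij, of "vsb_vir n i" n] by simp
qed


section \<open>Conjugation action and semidirect products\<close>

definition conj_act :: "nat \<Rightarrow> (nat \<Rightarrow> nat) \<Rightarrow> vsb_gen list set \<Rightarrow> vsb_gen list set"
  where "conj_act n \<alpha> = (\<lambda>\<beta>\<in>carrier (VSP n).
    sym_emb n \<alpha> \<otimes>\<^bsub>VSB n\<^esub> \<beta> \<otimes>\<^bsub>VSB n\<^esub> inv\<^bsub>VSB n\<^esub> (sym_emb n \<alpha>))"

definition semidirect ::
    "('a, 'c) monoid_scheme \<Rightarrow> ('b, 'd) monoid_scheme \<Rightarrow> ('b \<Rightarrow> 'a \<Rightarrow> 'a) \<Rightarrow> ('a \<times> 'b) monoid"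
  where "semidirect N H \<phi> =
    \<lparr>carrier = carrier N \<times> carrier H,
     mult = (\<lambda>(\<beta>, \<alpha>) (\<beta>', \<alpha>'). (\<beta> \<otimes>\<^bsub>N\<^esub> \<phi> \<alpha> \<beta>', \<alpha> \<otimes>\<^bsub>H\<^esub> \<alpha>')),
     one = (\<one>\<^bsub>N\<^esub>, \<one>\<^bsub>H\<^esub>)\<rparr>"

end

theory Submission
  imports Defs
begin

text \<open>
  Nothing specific to braids is used beyond the fact that the projection \<open>vsb_perm n\<close> onto the
  symmetric group is split by the embedding \<open>sym_emb n\<close>. For any homomorphism \<open>f\<close> from a monoid \<open>M\<close>
  to a group \<open>H\<close> with a homomorphic section \<open>s\<close>, the elements \<open>s h\<close> are units with inverse
  \<open>s (inv h)\<close>, so conjugation by them makes sense although \<open>M\<close> need not be a group. Since \<open>f\<close>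
  kills the conjugator together with its inverse, conjugation preserves the kernel
  (\<open>conj_in_kernel\<close>) and yields an action by automorphisms (\<open>conj_action_hom\<close>).
  Every \<open>x\<close> factors as \<open>x = (x \<otimes> inv (s (f x))) \<otimes> s (f x)\<close>, where the first factor lies in the
  kernel; the second factor is determined by \<open>f x\<close> and cancels because it is a unit, so the
  factorization is unique (\<open>semidirect_iso\<close>). Everything then follows from the splitting
  \<open>split_vsb_perm\<close>.
\<close>

locale split_monoid_hom = M?: monoid M + H: group H
  for M :: "('a, 'm) monoid_scheme" (structure) and H :: "('b, 'k) monoid_scheme" +
  fixes f :: "'a \<Rightarrow> 'b" and s :: "'b \<Rightarrow> 'a"
  assumes f_hom: "f \<in> hom M H"
    and s_hom: "s \<in> hom H M"
    and s_one: "s \<one>\<^bsub>H\<^esub> = \<one>"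
    and f_s: "h \<in> carrier H \<Longrightarrow> f (s h) = h"
begin

abbreviation K :: "'a set"
  where "K \<equiv> kernel M H f"

abbreviation conj_by :: "'b \<Rightarrow> 'a \<Rightarrow> 'a"
  where "conj_by h x \<equiv> s h \<otimes> x \<otimes> inv (s h)"

lemma f_closed [simp]: "x \<in> carrier M \<Longrightarrow> f x \<in> carrier H"
  using f_hom by (auto simp: hom_def)

lemma f_mult [simp]: "\<lbrakk>x \<in> carrier M; y \<in> carrier M\<rbrakk> \<Longrightarrow> f (x \<otimes> y) = f x \<otimes>\<^bsub>H\<^esub> f y"
  using f_hom by (rule hom_mult)

lemma s_closed [simp]: "h \<in> carrier H \<Longrightarrow> s h \<in> carrier M"
  using s_hom by (auto simp: hom_def)

lemma s_mult: "\<lbrakk>h \<in> carrier H; k \<in> carrier H\<rbrakk> \<Longrightarrow> s (h \<otimes>\<^bsub>H\<^esub> k) = s h \<otimes> s k"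
  using s_hom by (rule hom_mult)

lemma f_one: "f \<one> = \<one>\<^bsub>H\<^esub>"
  using f_s[OF H.one_closed] by (simp add: s_one)

lemma s_right_inv: "h \<in> carrier H \<Longrightarrow> s h \<otimes> s (inv\<^bsub>H\<^esub> h) = \<one>"
  by (simp flip: s_mult add: s_one)

lemma s_left_inv: "h \<in> carrier H \<Longrightarrow> s (inv\<^bsub>H\<^esub> h) \<otimes> s h = \<one>"
  by (simp flip: s_mult add: s_one)

lemma inv_s: "h \<in> carrier H \<Longrightarrow> inv (s h) = s (inv\<^bsub>H\<^esub> h)"
  by (rule M.inv_unique'[symmetric]) (simp_all add: s_left_inv s_right_inv)

lemma s_cancel_left: "\<lbrakk>h \<in> carrier H; x \<in> carrier M\<rbrakk> \<Longrightarrow> s (inv\<^bsub>H\<^esub> h) \<otimes> (s h \<otimes> x) = x"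
  by (simp flip: M.m_assoc add: s_left_inv)

lemma s_cancel_left': "\<lbrakk>h \<in> carrier H; x \<in> carrier M\<rbrakk> \<Longrightarrow> s h \<otimes> (s (inv\<^bsub>H\<^esub> h) \<otimes> x) = x"
  by (simp flip: M.m_assoc add: s_right_inv)

lemma kernel_iff: "x \<in> K \<longleftrightarrow> x \<in> carrier M \<and> f x = \<one>\<^bsub>H\<^esub>"
  by (simp add: kernel_def)

lemma kernel_carrier: "x \<in> K \<Longrightarrow> x \<in> carrier M"
  by (simp add: kernel_iff)

lemma submonoid_kernel: "submonoid K M"
  by (rule submonoid.intro) (auto simp: kernel_iff f_one)

lemma conj_in_kernel:
  assumes "h \<in> carrier H" "x \<in> K"
  shows "conj_by h x \<in> K"
  using assms by (simp add: kernel_iff inv_s f_s)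

lemma conj_inverse:
  assumes "h \<in> carrier H" "x \<in> carrier M"
  shows "conj_by h (conj_by (inv\<^bsub>H\<^esub> h) x) = x"
  using assms by (simp add: inv_s M.m_assoc s_cancel_left' s_right_inv)

lemma conj_mult:
  assumes "h \<in> carrier H" "x \<in> carrier M" "y \<in> carrier M"
  shows "conj_by h (x \<otimes> y) = conj_by h x \<otimes> conj_by h y"
  using assms by (simp add: inv_s M.m_assoc s_cancel_left)

lemma conj_comp:
  assumes "h \<in> carrier H" "k \<in> carrier H" "x \<in> carrier M"
  shows "conj_by (h \<otimes>\<^bsub>H\<^esub> k) x = conj_by h (conj_by k x)"
proof -
  have "inv (s (h \<otimes>\<^bsub>H\<^esub> k)) = inv (s k) \<otimes> inv (s h)"
    using assms by (subst inv_s) (simp_all add: inv_s H.inv_mult_group s_mult)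
  then show ?thesis
    using assms by (simp add: s_mult inv_s M.m_assoc)
qed

text \<open>Conjugation by \<open>s h\<close> and by \<open>s (inv h)\<close> both map the kernel into itself and undo each other;
  this is what upgrades the inclusion of \<open>conj_in_kernel\<close> to an equality.\<close>

lemma conj_image_kernel:
  assumes h: "h \<in> carrier H"
  shows "conj_by h ` K = K"
proof (intro equalityI subsetI)
  fix x assume "x \<in> conj_by h ` K"
  with h show "x \<in> K" using conj_in_kernel by blast
next
  fix x assume x: "x \<in> K"
  then have "x = conj_by h (conj_by (inv\<^bsub>H\<^esub> h) x)"
    using h by (simp add: conj_inverse kernel_iff)
  moreover have "conj_by (inv\<^bsub>H\<^esub> h) x \<in> K"
    using h x by (simp add: conj_in_kernel)
  ultimately show "x \<in> conj_by h ` K" by (rule image_eqI)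
qed

lemma kernel_conj_invariant:
  assumes "h \<in> carrier H"
  shows "(s h <# K) #> inv (s h) = K"
  using conj_image_kernel[OF assms] by (auto simp: l_coset_def r_coset_def)

lemma conj_inj: "h \<in> carrier H \<Longrightarrow> inj_on (conj_by h) K"
  using conj_inverse[of "inv\<^bsub>H\<^esub> h"]
  by (intro inj_on_inverseI[where g = "conj_by (inv\<^bsub>H\<^esub> h)"]) (simp add: kernel_iff)

lemma conj_auto:
  assumes h: "h \<in> carrier H"
  shows "restrict (conj_by h) K \<in> auto (M\<lparr>carrier := K\<rparr>)"
proof -
  have "restrict (conj_by h) K \<in> hom (M\<lparr>carrier := K\<rparr>) (M\<lparr>carrier := K\<rparr>)"
    using h submonoid.m_closed[OF submonoid_kernel]
    by (intro homI) (auto simp: conj_in_kernel conj_mult kernel_carrier)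
  moreover have "restrict (conj_by h) K \<in> Bij K"
    using conj_inj[OF h] conj_image_kernel[OF h] by (simp add: Bij_def bij_betw_def)
  ultimately show ?thesis by (simp add: auto_def)
qed

lemma conj_action_hom:
  "(\<lambda>h. restrict (conj_by h) K) \<in> hom H (AutoGroup (M\<lparr>carrier := K\<rparr>))"
proof (rule homI)
  fix h assume "h \<in> carrier H"
  then show "restrict (conj_by h) K \<in> carrier (AutoGroup (M\<lparr>carrier := K\<rparr>))"
    by (simp add: AutoGroup_def conj_auto)
next
  fix h k assume hk: "h \<in> carrier H" "k \<in> carrier H"
  have bij: "restrict (conj_by h) K \<in> Bij K" if "h \<in> carrier H" for h
    using conj_auto[OF that] by (simp add: auto_def)
  have "restrict (conj_by (h \<otimes>\<^bsub>H\<^esub> k)) K =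
      compose K (restrict (conj_by h) K) (restrict (conj_by k) K)"
    using hk conj_in_kernel[OF hk(2)] conj_comp[OF hk]
    by (auto simp: compose_def fun_eq_iff kernel_iff)
  with hk bij show "restrict (conj_by (h \<otimes>\<^bsub>H\<^esub> k)) K =
      restrict (conj_by h) K \<otimes>\<^bsub>AutoGroup (M\<lparr>carrier := K\<rparr>)\<^esub> restrict (conj_by k) K"
    by (simp add: AutoGroup_def BijGroup_def)
qed

lemma f_factorization:
  "\<lbrakk>x \<in> K; h \<in> carrier H\<rbrakk> \<Longrightarrow> f (x \<otimes> s h) = h"
  by (simp add: kernel_iff f_s)

text \<open>The multiplication of the semidirect product is forced by
  \<open>x \<otimes> s h \<otimes> (y \<otimes> s k) = x \<otimes> (s h \<otimes> y \<otimes> inv (s h)) \<otimes> (s h \<otimes> s k)\<close>. Applying \<open>f\<close> recovers the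
  second coordinate, and the first one is then recovered by cancelling the unit \<open>s h\<close>.\<close>

lemma semidirect_iso:
  "(\<lambda>(x, h). x \<otimes> s h) \<in>
    iso (semidirect (M\<lparr>carrier := K\<rparr>) H (\<lambda>h. restrict (conj_by h) K)) M"
    (is "?F \<in> iso ?S M")
proof -
  have "?F \<in> hom ?S M"
  proof (rule homI)
    fix p assume "p \<in> carrier ?S"
    then show "?F p \<in> carrier M"
      by (auto simp: semidirect_def kernel_iff)
  next
    fix p q assume "p \<in> carrier ?S" "q \<in> carrier ?S"
    then show "?F (p \<otimes>\<^bsub>?S\<^esub> q) = ?F p \<otimes> ?F q"
      by (auto simp: semidirect_def kernel_iff s_mult inv_s M.m_assoc s_cancel_left)
  qed
  moreover have "inj_on ?F (K \<times> carrier H)"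
  proof (rule inj_onI, clarify)
    fix x h y k
    assume x: "x \<in> K" and h: "h \<in> carrier H" and y: "y \<in> K" and k: "k \<in> carrier H"
      and eq: "x \<otimes> s h = y \<otimes> s k"
    have hk: "h = k"
      using f_factorization[OF x h] f_factorization[OF y k] eq by simp
    have "x = x \<otimes> s h \<otimes> s (inv\<^bsub>H\<^esub> h)"
      using x h by (simp add: kernel_iff M.m_assoc s_right_inv)
    also have "\<dots> = y \<otimes> s h \<otimes> s (inv\<^bsub>H\<^esub> h)"
      using eq hk by simp
    also have "\<dots> = y"
      using y h by (simp add: kernel_iff M.m_assoc s_right_inv)
    finally show "x = y \<and> h = k" using hk by simp
  qed
  moreover have "?F ` (K \<times> carrier H) = carrier M"
  proof (intro equalityI subsetI)
    fix z assume "z \<in> ?F ` (K \<times> carrier H)"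
    then show "z \<in> carrier M" by (auto simp: kernel_iff)
  next
    fix z assume z: "z \<in> carrier M"
    then have "z \<otimes> s (inv\<^bsub>H\<^esub> (f z)) \<in> K"
      by (simp add: kernel_iff f_s)
    moreover have "z = ?F (z \<otimes> s (inv\<^bsub>H\<^esub> (f z)), f z)"
      using z by (simp add: M.m_assoc s_left_inv)
    ultimately show "z \<in> ?F ` (K \<times> carrier H)"
      using z f_closed by blast
  qed
  ultimately show ?thesis
    by (simp add: iso_def bij_betw_def semidirect_def)
qed

end

text \<open>Membership in \<open>hom\<close> only requires a map to respect products, and a map between monoids
  that does so can send the unit to another idempotent. Here the unit is respected because the unit
  of \<open>VSB n\<close> lies in \<open>vsb_sym n\<close>, where \<open>vsb_perm n\<close> is injective.\<close>

lemma sym_emb_one: "sym_emb n \<one>\<^bsub>sym_group n\<^esub> = \<one>\<^bsub>VSB n\<^esub>"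
proof -
  have one: "\<one>\<^bsub>VSB n\<^esub> = vsb_class n []"
    by (simp add: VSB_def one_pres_monoid)
  have "vsb_perm n \<one>\<^bsub>VSB n\<^esub> = \<one>\<^bsub>sym_group n\<^esub>"
    unfolding one by (simp add: vsb_perm_class sym_group_one)
  moreover have "\<one>\<^bsub>VSB n\<^esub> \<in> vsb_sym n"
    unfolding vsb_sym_def by (rule generate.one)
  ultimately show ?thesis
    unfolding sym_emb_def using bij_betw_inv_into_left[OF vsb_perm_bij] by metis
qed

lemma sym_emb_image: "sym_emb n ` carrier (sym_group n) = vsb_sym n"
  using sym_emb_iso[of n] by (simp add: iso_def bij_betw_def)

lemma split_vsb_perm: "split_monoid_hom (VSB n) (sym_group n) (vsb_perm n) (sym_emb n)"
proof (intro split_monoid_hom.intro split_monoid_hom_axioms.intro)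
  have "vsb_sym n \<subseteq> carrier (VSB n)"
    unfolding vsb_sym_eq VSB_def carrier_pres_monoid using vir_lists by blast
  then show "sym_emb n \<in> hom (sym_group n) (VSB n)"
    using sym_emb_iso[of n] by (fastforce simp: iso_def hom_def)
  show "vsb_perm n (sym_emb n p) = p" if "p \<in> carrier (sym_group n)" for p
    unfolding sym_emb_def using bij_betw_inv_into_right[OF vsb_perm_bij that] .
qed (simp_all add: monoid_VSB sym_group_is_group vsb_perm_hom sym_emb_one)

theorem mainTheorem4:
  fixes n :: nat
  assumes "n \<ge> 2"
  shows "submonoid (carrier (VSP n)) (VSB n) \<and>
    (\<forall>\<alpha>\<in>vsb_sym n.
      (\<alpha> <#\<^bsub>VSB n\<^esub> carrier (VSP n)) #>\<^bsub>VSB n\<^esub> (inv\<^bsub>VSB n\<^esub> \<alpha>) = carrier (VSP n)) \<and>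
    conj_act n \<in> hom (sym_group n) (AutoGroup (VSP n)) \<and>
    (\<lambda>(\<beta>, \<alpha>). \<beta> \<otimes>\<^bsub>VSB n\<^esub> sym_emb n \<alpha>) \<in>
      iso (semidirect (VSP n) (sym_group n) (conj_act n)) (VSB n)"
proof -
  interpret split_monoid_hom "VSB n" "sym_group n" "vsb_perm n" "sym_emb n"
    by (rule split_vsb_perm)
  have carrier: "carrier (VSP n) = K"
    by (simp add: VSP_def)
  have act: "conj_act n = (\<lambda>\<alpha>. restrict (conj_by \<alpha>) K)"
    by (simp add: conj_act_def carrier fun_eq_iff)
  show ?thesis
    using submonoid_kernel kernel_conj_invariant conj_action_hom semidirect_iso
    by (simp add: carrier act flip: VSP_def sym_emb_image)
qed

end
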